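(* Let $G$ be a finite group and suppose $(S,T)$ is an $(s,t)$-$\lambda$-fold near-factorization of $G$, where $|G|=s+t$. Let $S^{(-1)}=\{x^{-1}:x\in S\}$. Then $S$ is an $(s+t,s,s-\lambda)$-difference set in $G$, and $T=G\setminus S^{(-1)}$ is an $(s+t,t,t-\lambda)$-difference set in $G$.
   Context: Subsets of $G$ are identified with the sums of their elements in the group ring $\mathbb{Z}[G]$; $e$ is the identity of $G$; for a subset $D$, $D^{(-1)}=\{d^{-1}:d\in D\}$. A $(v,k,\lambda)$-difference set in a group $G$ of order $v$ is a subset $D\subseteq G$ with $|D|=k$ and $DD^{(-1)}=k\cdot e+\lambda(G-e)$ in $\mathbb{Z}[G]$. For $S,T\subseteq G$ and a positive integer $\lambda$, $(S,T)$ is an $(s,t)$-$\lambda$-fold near-factorization of $G$ if $|S|=s$, $|T|=t$ and $ST=\lambda(G-e)$ in $\mathbb{Z}[G]$; that is, every non-identity element of $G$ can be written as $xy$ with $x\in S$, $y\in T$ in exactly $\lambda$ ways, and $xy\ne e$ for all $x\in S,y\in T$. *)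

theory Defs
  imports "HOL-Algebra.Coset" "HOL-Library.Indicator_Function"
begin

text \<open>
  For a finite group \<open>G\<close>, an element of the integral group ring of \<open>G\<close> is represented by its
  coefficient function \<open>'a \<Rightarrow> int\<close>, which vanishes outside the carrier. A subset \<open>A\<close> of \<open>G\<close>,
  identified with the sum of its elements, is \<open>indicator A\<close>, and the identity element of \<open>G\<close> is
  \<open>indicator {\<one>}\<close>. Addition and scalar multiplication are pointwise; the ring multiplication is
  the convolution below. The set of inverses of a subset is \<open>set_inv\<close> from the library.
\<close>

definition group_ring_mult ::
    "('a, 'b) monoid_scheme \<Rightarrow> ('a \<Rightarrow> int) \<Rightarrow> ('a \<Rightarrow> int) \<Rightarrow> 'a \<Rightarrow> int" where
  "group_ring_mult G a b =
     (\<lambda>g. \<Sum>(x, y) \<in> {(x, y) \<in> carrier G \<times> carrier G. x \<otimes>\<^bsub>G\<^esub> y = g}. a x * b y)"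

lemma group_ring_mult_indicator:
  assumes "finite (carrier G)" and "S \<subseteq> carrier G" and "T \<subseteq> carrier G"
  shows "group_ring_mult G (indicator S) (indicator T) g
           = int (card {(x, y) \<in> S \<times> T. x \<otimes>\<^bsub>G\<^esub> y = g})"
proof -
  let ?P = "{(x, y) \<in> carrier G \<times> carrier G. x \<otimes>\<^bsub>G\<^esub> y = g}"
  let ?Q = "{(x, y) \<in> S \<times> T. x \<otimes>\<^bsub>G\<^esub> y = g}"
  have fin: "finite ?P"
    by (rule finite_subset[of _ "carrier G \<times> carrier G"]) (use assms(1) in auto)
  have "?Q \<subseteq> ?P" using assms by auto
  then have "(\<Sum>(x, y) \<in> ?P. indicator S x * indicator T y :: int)
               = (\<Sum>(x, y) \<in> ?Q. 1)"
    by (intro sum.mono_neutral_cong_right fin) (auto simp: indicator_def)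
  then show ?thesis by (simp add: group_ring_mult_def case_prod_unfold)
qed

text \<open>
  The parameter \<open>l\<close> is an integer, so that differences such as \<open>s - \<lambda>\<close> can be used for it
  without truncation.
\<close>

definition difference_set ::
    "('a, 'b) monoid_scheme \<Rightarrow> nat \<Rightarrow> nat \<Rightarrow> int \<Rightarrow> 'a set \<Rightarrow> bool" where
  "difference_set G v k l D \<longleftrightarrow>
     finite (carrier G) \<and> order G = v \<and> D \<subseteq> carrier G \<and> card D = k \<and>
     group_ring_mult G (indicator D) (indicator (set_inv\<^bsub>G\<^esub> D))
       = (\<lambda>g. int k * indicator {\<one>\<^bsub>G\<^esub>} g
              + l * (indicator (carrier G) g - indicator {\<one>\<^bsub>G\<^esub>} g))"

definition near_factorization ::
    "('a, 'b) monoid_scheme \<Rightarrow> nat \<Rightarrow> nat \<Rightarrow> nat \<Rightarrow> 'a set \<Rightarrow> 'a set \<Rightarrow> bool" where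
  "near_factorization G s t l S T \<longleftrightarrow>
     finite (carrier G) \<and> S \<subseteq> carrier G \<and> T \<subseteq> carrier G \<and> l > 0 \<and> card S = s \<and> card T = t \<and>
     group_ring_mult G (indicator S) (indicator T)
       = (\<lambda>g. int l * (indicator (carrier G) g - indicator {\<one>\<^bsub>G\<^esub>} g))"

end

theory Submission
  imports Defs
begin

text \<open>
  Since \<open>\<one>\<close> is not in \<open>ST\<close>, \<open>T\<close> misses \<open>S\<^sup>-\<^sup>1\<close>, and \<open>|T| = |G| - |S|\<close> forces \<open>T = G - S\<^sup>-\<^sup>1\<close>; then
  \<open>S S\<^sup>-\<^sup>1 = S G - S T = s G - \<lambda> (G - e)\<close>. For \<open>T\<close>, the complement of a difference set is
  one, so it remains that \<open>D\<^sup>-\<^sup>1\<close> is a difference set when \<open>D\<close> is. Let \<open>c\<close> and \<open>d\<close> be the coefficient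
  functions of \<open>D\<^sup>-\<^sup>1 D\<close> and \<open>D D\<^sup>-\<^sup>1\<close>. Because \<open>x\<^sup>-\<^sup>1 y = z\<^sup>-\<^sup>1 w\<close> iff \<open>z x\<^sup>-\<^sup>1 = w y\<^sup>-\<^sup>1\<close>, one has
  \<open>\<Sum>c\<^sup>2 = \<Sum>d\<^sup>2\<close>. As \<open>d\<close> is a combination of \<open>e\<close> and \<open>G\<close>, on which \<open>c\<close> and \<open>d\<close> agree, also
  \<open>\<Sum>c d = \<Sum>d\<^sup>2\<close>, whence \<open>\<Sum>(c - d)\<^sup>2 = 0\<close>. This replaces the usual argument by invertibility of
  the incidence matrix.
\<close>

text \<open>The pairs lying in a common fibre form the disjoint union of the squares of the fibres.
  This turns a sum of squared coefficients into a count of quadruples.\<close>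

lemma sum_card_fibres_square:
  assumes "finite A" "finite B" "f ` A \<subseteq> B"
  shows "(\<Sum>b\<in>B. (card {p \<in> A. f p = b})\<^sup>2) = card {(p, q) \<in> A \<times> A. f p = f q}"
proof -
  have "{(p, q) \<in> A \<times> A. f p = f q} = (\<Union>b\<in>B. {p \<in> A. f p = b} \<times> {p \<in> A. f p = b})"
    using assms by auto
  also have "card \<dots> = (\<Sum>b\<in>B. card ({p \<in> A. f p = b} \<times> {p \<in> A. f p = b}))"
    using assms by (intro card_UN_disjoint) auto
  finally show ?thesis by (simp add: card_cartesian_product power2_eq_square)
qed

lemma group_ring_mult_diff_left:
  "group_ring_mult G (\<lambda>x. a x - b x) c = (\<lambda>g. group_ring_mult G a c g - group_ring_mult G b c g)"
  by (simp add: group_ring_mult_def case_prod_unfold left_diff_distrib sum_subtractf)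

lemma group_ring_mult_diff_right:
  "group_ring_mult G a (\<lambda>x. b x - c x) = (\<lambda>g. group_ring_mult G a b g - group_ring_mult G a c g)"
  by (simp add: group_ring_mult_def case_prod_unfold right_diff_distrib sum_subtractf)

lemma indicator_Diff_subset:
  assumes "A \<subseteq> B"
  shows "(indicator (B - A) :: 'a \<Rightarrow> int) = (\<lambda>x. indicator B x - indicator A x)"
  using assms by (auto simp: fun_eq_iff indicator_def)

context group
begin

section \<open>Sets of inverses\<close>

lemma set_inv_eq_image: "set_inv A = m_inv G ` A"
  by (auto simp: SET_INV_def)

lemma set_inv_subset: "A \<subseteq> carrier G \<Longrightarrow> set_inv A \<subseteq> carrier G"
  by (auto simp: set_inv_eq_image)

lemma inj_on_m_inv: "A \<subseteq> carrier G \<Longrightarrow> inj_on (m_inv G) A"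
  by (rule inj_on_inverseI[where g = "m_inv G"]) auto

lemma card_set_inv: "A \<subseteq> carrier G \<Longrightarrow> card (set_inv A) = card A"
  by (simp add: set_inv_eq_image card_image inj_on_m_inv)

lemma set_inv_set_inv: "A \<subseteq> carrier G \<Longrightarrow> set_inv (set_inv A) = A"
  by (simp add: set_inv_eq_image image_image subset_iff cong: image_cong_simp)

lemma mem_set_inv_iff:
  assumes "A \<subseteq> carrier G" "x \<in> carrier G"
  shows "x \<in> set_inv A \<longleftrightarrow> inv x \<in> A"
proof
  assume "x \<in> set_inv A"
  then show "inv x \<in> A" using assms(1) by (auto simp: set_inv_eq_image subset_iff)
next
  assume "inv x \<in> A"
  then have "inv (inv x) \<in> set_inv A" by (auto simp: set_inv_eq_image)
  then show "x \<in> set_inv A" using assms(2) by simp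
qed

lemma set_inv_Diff: "A \<subseteq> carrier G \<Longrightarrow> set_inv (carrier G - A) = carrier G - set_inv A"
  using set_inv_subset[of A] set_inv_subset[of "carrier G - A"]
  by (auto simp: mem_set_inv_iff)

section \<open>Products with the whole group and with a set of inverses\<close>

lemma group_ring_mult_outside_carrier: "g \<notin> carrier G \<Longrightarrow> group_ring_mult G a b g = 0"
  unfolding group_ring_mult_def by (rule sum.neutral) auto

text \<open>Once x in A is chosen, \<open>inv x \<otimes> g\<close> is the only possible second
  factor, so each g in G has one representation per element of A.\<close>

lemma group_ring_mult_carrier_right:
  assumes "finite (carrier G)" "A \<subseteq> carrier G"
  shows "group_ring_mult G (indicator A) (indicator (carrier G))
           = (\<lambda>g. int (card A) * indicator (carrier G) g)"
proof
  fix g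
  have "card {(x, y) \<in> A \<times> carrier G. x \<otimes> y = g} = card A" if "g \<in> carrier G"
    using that assms
    by (intro bij_betw_same_card[of fst] bij_betw_byWitness[where f' = "\<lambda>x. (x, inv x \<otimes> g)"])
      (auto simp: inv_solve_left subset_iff m_assoc[symmetric])
  then show "group_ring_mult G (indicator A) (indicator (carrier G)) g
      = int (card A) * indicator (carrier G) g"
    using assms
    by (cases "g \<in> carrier G")
      (simp add: group_ring_mult_indicator, simp add: group_ring_mult_outside_carrier)
qed

lemma group_ring_mult_carrier_left:
  assumes "finite (carrier G)" "A \<subseteq> carrier G"
  shows "group_ring_mult G (indicator (carrier G)) (indicator A)
           = (\<lambda>g. int (card A) * indicator (carrier G) g)"
proof
  fix g
  have "card {(x, y) \<in> carrier G \<times> A. x \<otimes> y = g} = card A" if "g \<in> carrier G"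
    using that assms
    by (intro bij_betw_same_card[of snd] bij_betw_byWitness[where f' = "\<lambda>y. (g \<otimes> inv y, y)"])
      (auto simp: subset_iff m_assoc)
  then show "group_ring_mult G (indicator (carrier G)) (indicator A) g
      = int (card A) * indicator (carrier G) g"
    using assms
    by (cases "g \<in> carrier G")
      (simp add: group_ring_mult_indicator, simp add: group_ring_mult_outside_carrier)
qed

text \<open>Here and in the mirror image below, moving the inverse from the set to the quotient map
  puts both products over the same index set \<open>A \<times> A\<close>, as the fibre count
  requires.\<close>

lemma group_ring_mult_set_inv_right:
  assumes "finite (carrier G)" "A \<subseteq> carrier G"
  shows "group_ring_mult G (indicator A) (indicator (set_inv A)) g
           = int (card {p \<in> A \<times> A. fst p \<otimes> inv (snd p) = g})"
proof -
  have "card {(x, y) \<in> A \<times> set_inv A. x \<otimes> y = g} = card {p \<in> A \<times> A. fst p \<otimes> inv (snd p) = g}"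
    using assms(2)
    by (intro bij_betw_same_card[of "map_prod id (m_inv G)"]
        bij_betw_byWitness[where f' = "map_prod id (m_inv G)"])
      (auto simp: set_inv_eq_image subset_iff)
  then show ?thesis
    using assms by (simp add: group_ring_mult_indicator set_inv_subset)
qed

lemma group_ring_mult_set_inv_left:
  assumes "finite (carrier G)" "A \<subseteq> carrier G"
  shows "group_ring_mult G (indicator (set_inv A)) (indicator A) g
           = int (card {p \<in> A \<times> A. inv (fst p) \<otimes> snd p = g})"
proof -
  have "card {(x, y) \<in> (set_inv A) \<times> A. x \<otimes> y = g} = card {p \<in> A \<times> A. inv (fst p) \<otimes> snd p = g}"
    using assms(2)
    by (intro bij_betw_same_card[of "map_prod (m_inv G) id"]
        bij_betw_byWitness[where f' = "map_prod (m_inv G) id"])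
      (auto simp: set_inv_eq_image subset_iff)
  then show ?thesis
    using assms by (simp add: group_ring_mult_indicator set_inv_subset)
qed

section \<open>Inverse and complement of a difference set\<close>

lemma inv_mult_eq_inv_mult_iff:
  assumes "x \<in> carrier G" "y \<in> carrier G" "z \<in> carrier G" "w \<in> carrier G"
  shows "inv x \<otimes> y = inv z \<otimes> w \<longleftrightarrow> z \<otimes> inv x = w \<otimes> inv y"
proof -
  have "inv x \<otimes> y = inv z \<otimes> w \<longleftrightarrow> z \<otimes> (inv x \<otimes> y) = w"
    using assms by (metis inv_closed inv_solve_left m_closed)
  also have "\<dots> \<longleftrightarrow> (z \<otimes> inv x) \<otimes> y = w"
    using assms by (simp add: m_assoc)
  also have "\<dots> \<longleftrightarrow> z \<otimes> inv x = w \<otimes> inv y"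
    using assms by (metis inv_closed inv_solve_right m_closed)
  finally show ?thesis .
qed

lemma sum_square_group_ring_mult_set_inv:
  assumes fin: "finite (carrier G)" and A: "A \<subseteq> carrier G"
  shows "(\<Sum>g\<in>carrier G. (group_ring_mult G (indicator (set_inv A)) (indicator A) g)\<^sup>2)
       = (\<Sum>g\<in>carrier G. (group_ring_mult G (indicator A) (indicator (set_inv A)) g)\<^sup>2)"
proof -
  let ?l = "\<lambda>p. inv (fst p) \<otimes> snd p" and ?r = "\<lambda>p. fst p \<otimes> inv (snd p)"
  have finA: "finite (A \<times> A)" using fin A finite_subset by blast
  \<comment> \<open>Regrouping the quadruple (x, y, z, w) as (z, x), (w, y) exchanges equality of
    left quotients with equality of right quotients.\<close>
  have "card {(p, q) \<in> (A \<times> A) \<times> (A \<times> A). ?l p = ?l q}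
      = card {(p, q) \<in> (A \<times> A) \<times> (A \<times> A). ?r p = ?r q}"
    using A
    by (intro bij_betw_same_card[of "\<lambda>((x, y), (z, w)). ((z, x), (w, y))"]
        bij_betw_byWitness[where f' = "\<lambda>((z, x), (w, y)). ((x, y), (z, w))"])
      (auto simp: inv_mult_eq_inv_mult_iff subset_iff)
  moreover have "?l ` (A \<times> A) \<subseteq> carrier G" "?r ` (A \<times> A) \<subseteq> carrier G"
    using A by (auto simp: subset_iff)
  ultimately have "(\<Sum>g\<in>carrier G. (card {p \<in> A \<times> A. ?l p = g})\<^sup>2)
      = (\<Sum>g\<in>carrier G. (card {p \<in> A \<times> A. ?r p = g})\<^sup>2)"
    using sum_card_fibres_square[OF finA fin, of ?l] sum_card_fibres_square[OF finA fin, of ?r]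
    by simp
  then have "int (\<Sum>g\<in>carrier G. (card {p \<in> A \<times> A. ?l p = g})\<^sup>2)
      = int (\<Sum>g\<in>carrier G. (card {p \<in> A \<times> A. ?r p = g})\<^sup>2)"
    by simp
  then show ?thesis
    by (simp only: group_ring_mult_set_inv_left[OF fin A] group_ring_mult_set_inv_right[OF fin A]
        of_nat_sum of_nat_power)
qed

text \<open>Summing coefficients is the augmentation map, which is multiplicative: each pair of
  \<open>A \<times> B\<close> is counted at exactly one g.\<close>

lemma sum_group_ring_mult:
  assumes "finite (carrier G)" "A \<subseteq> carrier G" "B \<subseteq> carrier G"
  shows "(\<Sum>g\<in>carrier G. group_ring_mult G (indicator A) (indicator B) g) = int (card A * card B)"
proof -
  have fin: "finite A" "finite B" using assms finite_subset by blast+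
  have "card (A \<times> B) = card (\<Union>g\<in>carrier G. {(x, y) \<in> A \<times> B. x \<otimes> y = g})"
    using assms by (intro arg_cong[where f = card]) (auto simp: subset_iff)
  also have "\<dots> = (\<Sum>g\<in>carrier G. card {(x, y) \<in> A \<times> B. x \<otimes> y = g})"
    using assms fin
    by (intro card_UN_disjoint) (auto intro: finite_subset[of _ "A \<times> B"])
  finally show ?thesis
    using assms by (simp add: group_ring_mult_indicator card_cartesian_product flip: of_nat_sum)
qed

lemma difference_set_set_inv:
  assumes "difference_set G v k l D"
  shows "difference_set G v k l (set_inv D)"
proof -
  let ?c = "group_ring_mult G (indicator (set_inv D)) (indicator D)"
  let ?d = "group_ring_mult G (indicator D) (indicator (set_inv D))"
  have fin: "finite (carrier G)" and D: "D \<subseteq> carrier G" and k: "card D = k"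
    and d: "?d = (\<lambda>g. int k * indicator {\<one>} g
              + l * (indicator (carrier G) g - indicator {\<one>} g))"
    using assms by (auto simp: difference_set_def)
  have dval: "?d g = (int k - l) * indicator {\<one>} g + l" if "g \<in> carrier G" for g
    using that by (simp add: d algebra_simps)
  \<comment> \<open>Pairing with \<open>?d\<close> sees only the value of f at the identity and the
    total of f, because \<open>?d\<close> is a combination of e and G.\<close>
  have comb: "(\<Sum>g\<in>carrier G. f g * ?d g) = (int k - l) * f \<one> + l * (\<Sum>g\<in>carrier G. f g)" for f
  proof -
    have "(\<Sum>g\<in>carrier G. f g * ?d g)
        = (\<Sum>g\<in>carrier G. (int k - l) * (if g = \<one> then f g else 0) + l * f g)"
      by (intro sum.cong) (auto simp: dval algebra_simps)
    also have "\<dots> = (int k - l) * f \<one> + l * (\<Sum>g\<in>carrier G. f g)"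
      using fin by (simp add: sum.distrib flip: sum_distrib_left)
    finally show ?thesis .
  qed
  have "{p \<in> D \<times> D. inv (fst p) \<otimes> snd p = \<one>} = (\<lambda>x. (x, x)) ` D"
  proof -
    have "inv x \<otimes> y = \<one> \<longleftrightarrow> y = x" if "x \<in> D" "y \<in> D" for x y
      using that D by (metis inv_closed inv_equality inv_inv l_inv subsetD)
    then show ?thesis by auto
  qed
  then have "?c \<one> = int k"
    by (simp add: group_ring_mult_set_inv_left[OF fin D] card_image inj_on_def k)
  moreover have "?d \<one> = int k" by (simp add: d)
  moreover have "(\<Sum>g\<in>carrier G. ?c g) = (\<Sum>g\<in>carrier G. ?d g)"
    using fin D by (simp add: sum_group_ring_mult set_inv_subset)
  \<comment> \<open>\<open>?c\<close> and \<open>?d\<close> share both data that \<open>comb\<close>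
    depends on: the value k at the identity and the total k * k.\<close>
  ultimately have "(\<Sum>g\<in>carrier G. ?c g * ?d g) = (\<Sum>g\<in>carrier G. ?d g * ?d g)"
    by (simp only: comb)
  \<comment> \<open>In the expanded square, the sums of \<open>?c * ?c\<close>,
    \<open>?c * ?d\<close> and \<open>?d * ?d\<close> all coincide, so the terms cancel.\<close>
  then have "(\<Sum>g\<in>carrier G. (?c g - ?d g)\<^sup>2) = 0"
    using sum_square_group_ring_mult_set_inv[OF fin D]
    by (simp add: power2_eq_square right_diff_distrib left_diff_distrib sum_subtractf
        sum.distrib mult.commute flip: sum_distrib_left)
  then have "?c g = ?d g" if "g \<in> carrier G" for g
    using fin that by (simp add: sum_nonneg_eq_0_iff)
  then have "?c = ?d"
    by (metis ext group_ring_mult_outside_carrier)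
  then show ?thesis
    using assms D by (simp add: difference_set_def set_inv_set_inv set_inv_subset card_set_inv)
qed

text \<open>Expanding (G - D)(G - D^-1) gives vG - kG - kG + D D^-1, which has coefficient v - k at
  e and v - 2k + l elsewhere.\<close>

lemma difference_set_compl:
  assumes "difference_set G v k l D"
  shows "difference_set G v (v - k) (int v - 2 * int k + l) (carrier G - D)"
proof -
  have fin: "finite (carrier G)" and v: "order G = v" and D: "D \<subseteq> carrier G" and k: "card D = k"
    and d: "group_ring_mult G (indicator D) (indicator (set_inv D))
      = (\<lambda>g. int k * indicator {\<one>} g + l * (indicator (carrier G) g - indicator {\<one>} g))"
    using assms by (auto simp: difference_set_def)
  have kv: "k \<le> v" using fin D k v by (auto simp: order_def intro: card_mono)
  have "group_ring_mult G (indicator (carrier G - D)) (indicator (set_inv (carrier G - D)))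
      = (\<lambda>g. int v * indicator (carrier G) g - int k * indicator (carrier G) g
             - (int k * indicator (carrier G) g
             - (int k * indicator {\<one>} g + l * (indicator (carrier G) g - indicator {\<one>} g))))"
    using fin D v k
    by (simp add: set_inv_Diff indicator_Diff_subset set_inv_subset group_ring_mult_diff_left
        group_ring_mult_diff_right group_ring_mult_carrier_left group_ring_mult_carrier_right
        card_set_inv order_def d algebra_simps)
  also have "\<dots> = (\<lambda>g. int (v - k) * indicator {\<one>} g
      + (int v - 2 * int k + l) * (indicator (carrier G) g - indicator {\<one>} g))"
    using kv by (auto simp: indicator_def of_nat_diff algebra_simps)
  finally show ?thesis
    using fin D v k by (simp add: difference_set_def card_Diff_subset finite_subset order_def)
qed

end

theorem theorem2p3:
  fixes G :: "('a, 'b) monoid_scheme" and S T :: "'a set" and s t l :: nat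
  assumes "group G" and "finite (carrier G)"
    and "near_factorization G s t l S T"
    and "order G = s + t"
  shows "difference_set G (s + t) s (int s - int l) S \<and>
         T = carrier G - set_inv\<^bsub>G\<^esub> S \<and>
         difference_set G (s + t) t (int t - int l) T"
proof -
  interpret group G by fact
  have fin: "finite (carrier G)" by fact
  have S: "S \<subseteq> carrier G" and T: "T \<subseteq> carrier G" and s: "card S = s" and t: "card T = t"
    and ST: "group_ring_mult G (indicator S) (indicator T)
      = (\<lambda>g. int l * (indicator (carrier G) g - indicator {\<one>\<^bsub>G\<^esub>} g))"
    using assms(3) by (auto simp: near_factorization_def)
  \<comment> \<open>Finiteness is what lets cardinality 0 imply emptiness, as \<open>card\<close> is
    also 0 on infinite sets.\<close>
  have "finite {(x, y) \<in> S \<times> T. x \<otimes>\<^bsub>G\<^esub> y = \<one>\<^bsub>G\<^esub>}"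
    using fin S T by (auto intro: finite_subset[of _ "carrier G \<times> carrier G"])
  moreover have "card {(x, y) \<in> S \<times> T. x \<otimes>\<^bsub>G\<^esub> y = \<one>\<^bsub>G\<^esub>} = 0"
    using fun_cong[OF ST, of "\<one>\<^bsub>G\<^esub>"] fin S T by (simp add: group_ring_mult_indicator)
  ultimately have "x \<otimes>\<^bsub>G\<^esub> y \<noteq> \<one>\<^bsub>G\<^esub>" if "x \<in> S" "y \<in> T" for x y
    using that by auto
  then have "T \<subseteq> carrier G - set_inv\<^bsub>G\<^esub> S"
    using S T by (force simp: set_inv_eq_image subset_iff)
  \<comment> \<open>The assumption |G| = s + t enters here: the complement has exactly t elements,
    so the inclusion just shown is an equality.\<close>
  moreover have "card (carrier G - set_inv\<^bsub>G\<^esub> S) = card T"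
    using fin S s t assms(4) set_inv_subset[OF S]
    by (simp add: card_Diff_subset finite_subset card_set_inv order_def)
  ultimately have T_eq: "T = carrier G - set_inv\<^bsub>G\<^esub> S"
    using fin by (simp add: card_subset_eq)
  have "(\<lambda>g. int s * indicator (carrier G) g
        - group_ring_mult G (indicator S) (indicator (set_inv\<^bsub>G\<^esub> S)) g)
      = (\<lambda>g. int l * (indicator (carrier G) g - indicator {\<one>\<^bsub>G\<^esub>} g))"
    using ST fin S s
    by (simp add: T_eq indicator_Diff_subset set_inv_subset group_ring_mult_diff_right
        group_ring_mult_carrier_right)
  then have "group_ring_mult G (indicator S) (indicator (set_inv\<^bsub>G\<^esub> S))
      = (\<lambda>g. int s * indicator {\<one>\<^bsub>G\<^esub>} g
          + (int s - int l) * (indicator (carrier G) g - indicator {\<one>\<^bsub>G\<^esub>} g))"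
    by (auto simp: fun_eq_iff algebra_simps)
  then have S_ds: "difference_set G (s + t) s (int s - int l) S"
    using fin S s assms(4) by (simp add: difference_set_def)
  \<comment> \<open>With v = s + t, k = s and index s - \<lambda>, the complement of S^-1 has size v
    - k = t and index v - 2s + (s - \<lambda>) = t - \<lambda>.\<close>
  have "difference_set G (s + t) t (int t - int l) T"
    using difference_set_compl[OF difference_set_set_inv[OF S_ds]]
    by (simp add: T_eq algebra_simps)
  with S_ds T_eq show ?thesis by blast
qed

end
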